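(* Let $\sigma_1,\sigma_2$ be weight functions on $T$, let $\varphi:T\to T$ be a self map and $\psi:T\to\mathbb{C}$ a function. For $0<p<\infty$, the operator $W_{\psi,\varphi}:\mathbb{T}_{\sigma_1,p}\to\mathbb{T}_{\sigma_2,\infty}$, $W_{\psi,\varphi}(f)=\psi\,(f\circ\varphi)$, is bounded if and only if $$M=\sup_{x\in T}\frac{\sigma_2(x)|\psi(x)|}{\sigma_1(\varphi(x))}\left(c_{|\varphi(x)|}\right)^{1/p}<\infty.$$ Furthermore, $\|W_{\psi,\varphi}\|=M$.
   Context: $T$ is an infinite rooted tree, identified with its vertex set; $|x|$ is the edge-counting distance from the root $o$ to the vertex $x$; $D_n=\{x\in T:|x|=n\}$ and $c_n$ is the number of elements of $D_n$ for $n\in\mathbb{N}_0=\{0,1,2,\dots\}$. Standing assumptions: every $c_n$ is finite and the sequence $\{c_n\}$ is unbounded. A weight function is a function $\sigma:T\to(0,\infty)$. For a weight $\sigma$, $0<p<\infty$ and $f:T\to\mathbb{C}$, put $M_{\sigma,p}(n,f)=\left(\frac{1}{c_n}\sum_{|x|=n}\sigma(x)^p|f(x)|^p\right)^{1/p}$ and $\|f\|_{\sigma,p}=\sup_{n\in\mathbb{N}_0}M_{\sigma,p}(n,f)$; for $p=\infty$ put $\|f\|_{\sigma,\infty}=\sup_{x\in T}\sigma(x)|f(x)|$. The space $\mathbb{T}_{\sigma,p}$ is the set of all $f:T\to\mathbb{C}$ with $\|f\|_{\sigma,p}<\infty$. A linear operator $A:X\to Y$ between such spaces is bounded if it maps $X$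 into $Y$ and $\|Af\|_Y\le C\|f\|_X$ for some constant $C$ and all $f\in X$; $\|A\|$ is the least such $C$. *)

theory Defs
  imports "HOL-Analysis.Analysis" "Graph_Theory.Digraph_Component"
begin

text \<open>
  The tree is identified with its vertex set, which is the whole type. An undirected simple graph is
  a symmetric loop-free digraph, in which an edge traversed back and forth is a cycle with two arcs.
  The undirected cycles are therefore those with at least three arcs, and the predicates
  \<^const>\<open>forest\<close> and \<^const>\<open>tree\<close>, which forbid all directed cycles, do not apply.
\<close>

definition dist_from :: "'v pair_pre_digraph \<Rightarrow> 'v \<Rightarrow> 'v \<Rightarrow> nat" where
  "dist_from G r x = (LEAST n. \<exists>p. pre_digraph.awalk (with_proj G) r p x \<and> length p = n)"

definition level :: "'v pair_pre_digraph \<Rightarrow> 'v \<Rightarrow> nat \<Rightarrow> 'v set" where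
  "level G r n = {x. dist_from G r x = n}"

locale unbounded_rooted_tree = pair_bidirected_digraph G
  for G :: "'v pair_pre_digraph" +
  fixes r :: 'v
  assumes verts_UNIV: "pverts G = UNIV"
    and infinite_verts: "infinite (pverts G)"
    and connected: "strongly_connected (with_proj G)"
    and acyclic: "\<not> (\<exists>p. pre_digraph.cycle (with_proj G) p \<and> 3 \<le> length p)"
    and finite_level: "finite (level G r n)"
    and unbounded_levels: "\<not> bdd_above (range (\<lambda>n. card (level G r n)))"

definition weight :: "('v \<Rightarrow> real) \<Rightarrow> bool" where
  "weight \<sigma> \<longleftrightarrow> (\<forall>x. 0 < \<sigma> x)"

definition level_mean ::
  "'v pair_pre_digraph \<Rightarrow> 'v \<Rightarrow> ('v \<Rightarrow> real) \<Rightarrow> real \<Rightarrow> nat \<Rightarrow> ('v \<Rightarrow> complex) \<Rightarrow> real" where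
  "level_mean G r \<sigma> p n f =
     (1 / real (card (level G r n)) * (\<Sum>x\<in>level G r n. \<sigma> x powr p * cmod (f x) powr p)) powr (1 / p)"

definition T_norm ::
  "'v pair_pre_digraph \<Rightarrow> 'v \<Rightarrow> ('v \<Rightarrow> real) \<Rightarrow> real \<Rightarrow> ('v \<Rightarrow> complex) \<Rightarrow> ennreal" where
  "T_norm G r \<sigma> p f = (SUP n. ennreal (level_mean G r \<sigma> p n f))"

definition T_norm_inf :: "('v \<Rightarrow> real) \<Rightarrow> ('v \<Rightarrow> complex) \<Rightarrow> ennreal" where
  "T_norm_inf \<sigma> f = (SUP x. ennreal (\<sigma> x * cmod (f x)))"

text \<open>A space is given by its extended (quasi-)norm and consists of the functions of finite norm.\<close>

definition space_of :: "(('v \<Rightarrow> complex) \<Rightarrow> ennreal) \<Rightarrow> ('v \<Rightarrow> complex) set" where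
  "space_of N = {f. N f < \<infinity>}"

definition linear_operator ::
  "('v \<Rightarrow> complex) set \<Rightarrow> (('v \<Rightarrow> complex) \<Rightarrow> ('v \<Rightarrow> complex)) \<Rightarrow> bool" where
  "linear_operator X A \<longleftrightarrow>
     (\<forall>f\<in>X. \<forall>g\<in>X. \<forall>a b. A (\<lambda>x. a * f x + b * g x) = (\<lambda>x. a * A f x + b * A g x))"

text \<open>The condition \<open>0 \<le> C\<close> is needed because \<^const>\<open>ennreal\<close> truncates negative numbers to 0.\<close>

definition operator_bound ::
  "(('v \<Rightarrow> complex) \<Rightarrow> ennreal) \<Rightarrow> (('v \<Rightarrow> complex) \<Rightarrow> ennreal) \<Rightarrow>
   (('v \<Rightarrow> complex) \<Rightarrow> ('v \<Rightarrow> complex)) \<Rightarrow> real \<Rightarrow> bool" where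
  "operator_bound NX NY A C \<longleftrightarrow> 0 \<le> C \<and> (\<forall>f\<in>space_of NX. NY (A f) \<le> ennreal C * NX f)"

definition bounded_operator ::
  "(('v \<Rightarrow> complex) \<Rightarrow> ennreal) \<Rightarrow> (('v \<Rightarrow> complex) \<Rightarrow> ennreal) \<Rightarrow>
   (('v \<Rightarrow> complex) \<Rightarrow> ('v \<Rightarrow> complex)) \<Rightarrow> bool" where
  "bounded_operator NX NY A \<longleftrightarrow>
     linear_operator (space_of NX) A \<and> A ` space_of NX \<subseteq> space_of NY \<and> (\<exists>C. operator_bound NX NY A C)"

definition operator_norm ::
  "(('v \<Rightarrow> complex) \<Rightarrow> ennreal) \<Rightarrow> (('v \<Rightarrow> complex) \<Rightarrow> ennreal) \<Rightarrow>
   (('v \<Rightarrow> complex) \<Rightarrow> ('v \<Rightarrow> complex)) \<Rightarrow> real" where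
  "operator_norm NX NY A = (LEAST C. operator_bound NX NY A C)"

definition weighted_comp ::
  "('v \<Rightarrow> complex) \<Rightarrow> ('v \<Rightarrow> 'v) \<Rightarrow> ('v \<Rightarrow> complex) \<Rightarrow> ('v \<Rightarrow> complex)" where
  "weighted_comp \<psi> \<phi> f = (\<lambda>x. \<psi> x * (f \<circ> \<phi>) x)"

end

theory Submission
  imports Defs
begin

text \<open>
  Everything rests on the point evaluations: on \<open>T_norm G r \<sigma> p\<close> the functional \<open>f \<mapsto> f y\<close> has norm
  \<open>c powr (1 / p) / \<sigma> y\<close>, where \<open>c\<close> is the size of the level of \<open>y\<close>. The upper estimate drops all other
  terms of the sum over that level, and the indicator function of \<open>y\<close> attains it. As the target
  norm is a supremum over \<open>x\<close> of multiples of point evaluations at \<open>\<phi> x\<close>, the constants \<open>C\<close> that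
  bound the operator are exactly those with \<open>M \<le> C\<close>.
\<close>

lemma mem_level_dist_from: "x \<in> level G r (dist_from G r x)"
  by (simp add: level_def)

lemma card_level_dist_from_pos:
  assumes "finite (level G r (dist_from G r x))"
  shows "0 < card (level G r (dist_from G r x))"
  using assms mem_level_dist_from[of x G r] by (auto simp: card_gt_0_iff)

text \<open>One summand of a sum of nonnegative terms is at most the whole sum. The mean divides
  that sum by the size \<open>c\<close> of the level, so after the root a factor
  \<open>c powr (1 / p)\<close> remains.\<close>

lemma point_le_level_mean:
  assumes "finite (level G r n)" "y \<in> level G r n" "0 < p" "0 < \<sigma> y"
  shows "\<sigma> y * cmod (f y) \<le> real (card (level G r n)) powr (1 / p) * level_mean G r \<sigma> p n f"
proof -
  let ?c = "real (card (level G r n))"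
  let ?S = "\<Sum>x\<in>level G r n. \<sigma> x powr p * cmod (f x) powr p"
  have c: "0 < ?c"
    using assms(1,2) by (auto simp: card_gt_0_iff)
  have "(\<sigma> y * cmod (f y)) powr p \<le> ?S"
    using member_le_sum[of y "level G r n" "\<lambda>x. \<sigma> x powr p * cmod (f x) powr p"] assms
    by (simp add: powr_mult)
  then have "((\<sigma> y * cmod (f y)) powr p) powr (1 / p) \<le> ?S powr (1 / p)"
    using assms(3) by (intro powr_mono2) auto
  moreover have "((\<sigma> y * cmod (f y)) powr p) powr (1 / p) = \<sigma> y * cmod (f y)"
    using assms(3,4) by (simp add: powr_powr)
  moreover have "?S powr (1 / p) = (?c * (1 / ?c * ?S)) powr (1 / p)"
    using c by simp
  moreover have "\<dots> = ?c powr (1 / p) * level_mean G r \<sigma> p n f"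
    unfolding level_mean_def by (rule powr_mult)
  ultimately show ?thesis by simp
qed

text \<open>The mean over the level of \<open>y\<close> is one of the terms of the supremum. In
  \<open>ennreal\<close> the estimate also makes sense when \<open>T_norm\<close> is
  infinite.\<close>

lemma point_le_T_norm:
  assumes "finite (level G r (dist_from G r y))" "0 < p" "0 < \<sigma> y"
  shows "ennreal (cmod (f y)) \<le>
    ennreal (real (card (level G r (dist_from G r y))) powr (1 / p) / \<sigma> y) * T_norm G r \<sigma> p f"
proof -
  let ?n = "dist_from G r y"
  let ?k = "real (card (level G r ?n)) powr (1 / p)"
  have "cmod (f y) \<le> ?k / \<sigma> y * level_mean G r \<sigma> p ?n f"
    using point_le_level_mean[OF assms(1) mem_level_dist_from assms(2), of \<sigma> f] assms(3)
    by (simp add: field_simps)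
  then have "ennreal (cmod (f y)) \<le> ennreal (?k / \<sigma> y) * ennreal (level_mean G r \<sigma> p ?n f)"
    using assms(3) by (simp add: ennreal_mult'[symmetric] ennreal_leI)
  also have "\<dots> \<le> ennreal (?k / \<sigma> y) * T_norm G r \<sigma> p f"
    unfolding T_norm_def by (intro mult_left_mono SUP_upper) auto
  finally show ?thesis .
qed

text \<open>Only the level of \<open>y\<close> contributes to the supremum. The value obtained turns
  \<open>point_le_T_norm\<close> into an equality, so the constant there is sharp.\<close>

lemma T_norm_indicator_singleton:
  assumes "finite (level G r (dist_from G r y))" "0 < p" "0 < \<sigma> y"
  shows "T_norm G r \<sigma> p (indicator {y}) =
    ennreal (\<sigma> y / real (card (level G r (dist_from G r y))) powr (1 / p))"
proof -
  let ?m = "\<lambda>n. level_mean G r \<sigma> p n (indicator {y})"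
  let ?k = "\<sigma> y / real (card (level G r (dist_from G r y))) powr (1 / p)"
  have "(\<Sum>x\<in>level G r (dist_from G r y). \<sigma> x powr p * cmod (indicator {y} x) powr p) =
      (\<Sum>x\<in>level G r (dist_from G r y). if x = y then \<sigma> y powr p else 0)"
    by (intro sum.cong) auto
  also have "\<dots> = \<sigma> y powr p"
    using assms(1) mem_level_dist_from[of y G r] by simp
  finally have own: "?m (dist_from G r y) = ?k"
    using assms(2,3) by (simp add: level_mean_def powr_divide powr_powr)
  \<comment> \<open>Each vertex lies on exactly one level, so the sum vanishes and the mean is
    \<open>0 powr (1 / p)\<close>, which is 0.\<close>
  have other: "?m n = 0" if "n \<noteq> dist_from G r y" for n
  proof -
    have "(\<Sum>x\<in>level G r n. \<sigma> x powr p * cmod (indicator {y} x) powr p) = 0"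
      using that by (intro sum.neutral) (auto simp: level_def indicator_def)
    then show ?thesis by (simp add: level_mean_def)
  qed
  show ?thesis
    unfolding T_norm_def
  proof (rule antisym)
    show "(SUP n. ennreal (?m n)) \<le> ennreal ?k"
      by (rule SUP_least) (metis own other ennreal_0 order_refl zero_le)
    show "ennreal ?k \<le> (SUP n. ennreal (?m n))"
      by (metis own SUP_upper UNIV_I)
  qed
qed

lemma linear_operator_weighted_comp: "linear_operator X (weighted_comp \<psi> \<phi>)"
  by (simp add: linear_operator_def weighted_comp_def algebra_simps)

text \<open>Describing all admissible \<open>C\<close> at once settles both boundedness (some
  \<open>C\<close> exists) and the norm (the least \<open>C\<close>). An infinite supremum admits no
  \<open>C\<close>.\<close>

lemma operator_bound_weighted_comp_iff:
  assumes fin: "\<And>n. finite (level G r n)" and "weight \<sigma>\<^sub>1" "weight \<sigma>\<^sub>2" and p: "0 < p"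
  shows "operator_bound (T_norm G r \<sigma>\<^sub>1 p) (T_norm_inf \<sigma>\<^sub>2) (weighted_comp \<psi> \<phi>) C \<longleftrightarrow>
    0 \<le> C \<and> (SUP x. ennreal (\<sigma>\<^sub>2 x * cmod (\<psi> x) / \<sigma>\<^sub>1 (\<phi> x) *
      real (card (level G r (dist_from G r (\<phi> x)))) powr (1 / p))) \<le> ennreal C"
    (is "?B \<longleftrightarrow> 0 \<le> C \<and> (SUP x. ennreal (?w x)) \<le> _")
proof (intro iffI conjI)
  let ?c = "\<lambda>x. real (card (level G r (dist_from G r (\<phi> x)))) powr (1 / p)"
  have s1: "0 < \<sigma>\<^sub>1 x" and s2: "0 < \<sigma>\<^sub>2 x" for x
    using assms(2,3) by (auto simp: weight_def)
  have c: "0 < ?c x" for x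
    using card_level_dist_from_pos[OF fin] by simp
  {
    assume ?B
    then show C: "0 \<le> C" by (simp add: operator_bound_def)
    show "(SUP x. ennreal (?w x)) \<le> ennreal C"
    proof (rule SUP_least)
      fix x
      \<comment> \<open>The extremal function for evaluation at \<open>\<phi> x\<close>; its image
        under the operator takes the value \<open>\<psi> x\<close> at \<open>x\<close>.\<close>
      let ?e = "indicator {\<phi> x} :: _ \<Rightarrow> complex"
      have e: "T_norm G r \<sigma>\<^sub>1 p ?e = ennreal (\<sigma>\<^sub>1 (\<phi> x) / ?c x)"
        by (rule T_norm_indicator_singleton[OF fin p s1])
      then have in_space: "?e \<in> space_of (T_norm G r \<sigma>\<^sub>1 p)"
        by (simp add: space_of_def)
      have "ennreal (\<sigma>\<^sub>2 x * cmod (\<psi> x)) \<le> T_norm_inf \<sigma>\<^sub>2 (weighted_comp \<psi> \<phi> ?e)"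
        unfolding T_norm_inf_def by (rule SUP_upper2[of x]) (auto simp: weighted_comp_def)
      also have "\<dots> \<le> ennreal C * T_norm G r \<sigma>\<^sub>1 p ?e"
        using \<open>?B\<close> in_space unfolding operator_bound_def by blast
      also have "\<dots> = ennreal (C * (\<sigma>\<^sub>1 (\<phi> x) / ?c x))"
        unfolding e by (rule ennreal_mult'[OF C, symmetric])
      finally have "\<sigma>\<^sub>2 x * cmod (\<psi> x) \<le> C * (\<sigma>\<^sub>1 (\<phi> x) / ?c x)"
        using C s1[of "\<phi> x"] by (subst (asm) ennreal_le_iff) auto
      then show "ennreal (?w x) \<le> ennreal C"
        using s1[of "\<phi> x"] c[of x] by (intro ennreal_leI) (simp add: field_simps)
    qed
  }
  assume *: "0 \<le> C \<and> (SUP x. ennreal (?w x)) \<le> ennreal C"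
  have "T_norm_inf \<sigma>\<^sub>2 (weighted_comp \<psi> \<phi> f) \<le> ennreal C * T_norm G r \<sigma>\<^sub>1 p f" for f
    unfolding T_norm_inf_def
  proof (rule SUP_least)
    fix x
    have "ennreal (\<sigma>\<^sub>2 x * cmod (weighted_comp \<psi> \<phi> f x)) =
        ennreal (\<sigma>\<^sub>2 x * cmod (\<psi> x)) * ennreal (cmod (f (\<phi> x)))"
      using s2[of x] by (simp add: weighted_comp_def norm_mult mult.assoc ennreal_mult[symmetric])
    also have "\<dots> \<le> ennreal (\<sigma>\<^sub>2 x * cmod (\<psi> x)) *
        (ennreal (?c x / \<sigma>\<^sub>1 (\<phi> x)) * T_norm G r \<sigma>\<^sub>1 p f)"
      by (intro mult_left_mono point_le_T_norm fin p s1) auto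
    \<comment> \<open>The multiplier at \<open>x\<close> and the constant of the evaluation at
      \<open>\<phi> x\<close> combine to the term of \<open>M\<close> belonging to
      \<open>x\<close>.\<close>
    also have "\<dots> = ennreal (?w x) * T_norm G r \<sigma>\<^sub>1 p f"
      using s2[of x] s1[of "\<phi> x"]
      by (simp add: mult.assoc[symmetric] ennreal_mult[symmetric])
    also have "\<dots> \<le> ennreal C * T_norm G r \<sigma>\<^sub>1 p f"
      using * by (intro mult_right_mono) (auto simp: SUP_le_iff)
    finally show "ennreal (\<sigma>\<^sub>2 x * cmod (weighted_comp \<psi> \<phi> f x)) \<le> ennreal C * T_norm G r \<sigma>\<^sub>1 p f" .
  qed
  then show ?B using * by (simp add: operator_bound_def)
qed

text \<open>A finite constant times a finite norm is finite, so any bound already forces the image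
  into the target space; linearity is pointwise.\<close>

lemma bounded_operator_weighted_comp_iff:
  "bounded_operator NX NY (weighted_comp \<psi> \<phi>) \<longleftrightarrow> (\<exists>C. operator_bound NX NY (weighted_comp \<psi> \<phi>) C)"
proof -
  have "weighted_comp \<psi> \<phi> ` space_of NX \<subseteq> space_of NY"
    if "operator_bound NX NY (weighted_comp \<psi> \<phi>) C" for C
  proof (rule image_subsetI)
    fix f assume f: "f \<in> space_of NX"
    have "NY (weighted_comp \<psi> \<phi> f) \<le> ennreal C * NX f"
      using that f by (simp add: operator_bound_def)
    also have "\<dots> < \<infinity>"
      using f by (simp add: space_of_def ennreal_mult_less_top)
    finally show "weighted_comp \<psi> \<phi> f \<in> space_of NY" by (simp add: space_of_def)
  qed
  then show ?thesis
    unfolding bounded_operator_def using linear_operator_weighted_comp by blast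
qed

theorem theorem5:
  fixes G :: "'v pair_pre_digraph" and r :: 'v
    and \<sigma>\<^sub>1 \<sigma>\<^sub>2 :: "'v \<Rightarrow> real" and \<phi> :: "'v \<Rightarrow> 'v" and \<psi> :: "'v \<Rightarrow> complex"
    and p :: real and M :: ennreal
  defines "M \<equiv> (SUP x. ennreal (\<sigma>\<^sub>2 x * cmod (\<psi> x) / \<sigma>\<^sub>1 (\<phi> x) *
                 real (card (level G r (dist_from G r (\<phi> x)))) powr (1 / p)))"
  assumes "unbounded_rooted_tree G r"
    and "weight \<sigma>\<^sub>1" and "weight \<sigma>\<^sub>2"
    and "0 < p"
  shows "(bounded_operator (T_norm G r \<sigma>\<^sub>1 p) (T_norm_inf \<sigma>\<^sub>2) (weighted_comp \<psi> \<phi>) \<longleftrightarrow> M < \<infinity>) \<and>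
         (bounded_operator (T_norm G r \<sigma>\<^sub>1 p) (T_norm_inf \<sigma>\<^sub>2) (weighted_comp \<psi> \<phi>) \<longrightarrow>
            ennreal (operator_norm (T_norm G r \<sigma>\<^sub>1 p) (T_norm_inf \<sigma>\<^sub>2) (weighted_comp \<psi> \<phi>)) = M)"
proof -
  let ?B = "operator_bound (T_norm G r \<sigma>\<^sub>1 p) (T_norm_inf \<sigma>\<^sub>2) (weighted_comp \<psi> \<phi>)"
  have B: "?B C \<longleftrightarrow> 0 \<le> C \<and> M \<le> ennreal C" for C
    unfolding M_def using assms(2-5)
    by (intro operator_bound_weighted_comp_iff unbounded_rooted_tree.finite_level)
  \<comment> \<open>For infinite \<open>M\<close> no \<open>C\<close> satisfies \<open>?B\<close>,
    and \<open>LEAST\<close> would be unspecified.\<close>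
  have "ennreal (operator_norm (T_norm G r \<sigma>\<^sub>1 p) (T_norm_inf \<sigma>\<^sub>2) (weighted_comp \<psi> \<phi>)) = M"
    if "M < \<infinity>"
  proof -
    \<comment> \<open>On nonnegative reals \<open>ennreal\<close> reflects the order, so
      \<open>?B C\<close> amounts to \<open>m \<le> C\<close> and the least such \<open>C\<close> is
      \<open>m\<close> itself.\<close>
    obtain m where m: "0 \<le> m" "M = ennreal m"
      using \<open>M < \<infinity>\<close> by (cases M) auto
    then have "(LEAST C. ?B C) = m"
      by (intro Least_equality) (auto simp: B)
    with m show ?thesis by (simp add: operator_norm_def)
  qed
  moreover have "(\<exists>C. ?B C) \<longleftrightarrow> M < \<infinity>"
  proof
    assume "\<exists>C. ?B C"
    then show "M < \<infinity>" using B by (auto intro: le_less_trans)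
  next
    assume "M < \<infinity>"
    then show "\<exists>C. ?B C" by (cases M) (auto simp: B)
  qed
  ultimately show ?thesis
    by (simp add: bounded_operator_weighted_comp_iff)
qed

end
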